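(* Let $n,k$ be positive integers with $k\ge 2$, let $\zeta$ be a primitive $k$-th root of unity, let $H=[\zeta^{a_{ij}}]$ be a normalized $\mathrm{BH}(n,k)$ matrix, let $H'=[a_{ij}]$ (entries in $\mathbb{Z}_k$), let $N$ be the set of all $k$-th roots of unity, and let $l=\min\{i\ge 2 : i\mid k\}$. With minimum distances taken with respect to the Hamming distance: (i) the code $A_k$ consisting of the rows of $H'$ with the first column deleted is a $k$-ary $(n-1,n,d_A)$ code with $d_A\ge n-\frac{n}{l}$; (ii) the code $B_k$ consisting of the rows of the exponent matrices of the translates $uH$, $u\in N$, with the first column deleted is a $k$-ary $(n-1,nk,d_B)$ code with $d_B\ge n-\frac{n}{l}-1$; (iii) the code $C_k$ consisting of the rows of the exponent matrices of the translates $uH$, $u\in N$, is a $k$-ary $(n,nk,d_C)$ code with $d_C\ge n-\frac{n}{l}$; (iv) if $n=k$, then, for any fixed noninitial column $c$ of $H$, the code $D_k$ consisting of the rows of the exponent matrices of $(uH)c$ (the matrix $uH$ with the column $c$ appended), $u\in N$, is a $k$-ary $(n+1,n^2,d_D)$ code with $d_D\ge n-\frac{n}{l}$.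
   Context: A Butson-Hadamard matrix $\mathrm{BH}(n,k)$ is an $n\times n$ complex matrix $H$ whose entries are $k$-th roots of unity and which satisfies $HH^*=nI_n$, where $H^*$ is the Hermitian transpose. It is normalized if its first row and first column consist entirely of 1s. The exponent matrix of a matrix $[\zeta^{b_{ij}}]$ is $[b_{ij}]$, with entries in $\mathbb{Z}_k$; thus for $u=\zeta^s$ the exponent matrix of the translate $uH$ is $[a_{ij}+s]$. The codewords of $D_k$ are the words $(a_{i1}+s,\dots,a_{in}+s,a_{ic})$ for $1\le i\le n$, $s\in\mathbb{Z}_k$, where $c\in\{2,\dots,n\}$ is the index of the fixed column (the appended column is always that of $H$, not of $uH$). A $k$-ary $(m,M,d)$ code is a nonempty subset of $\mathbb{Z}_k^m$ of size $M$ with minimum distance $d$.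
   Formalization: In (ii) the size nk of B_k is claimed only for n ≥ 3, since it is false for n = 1 (B_k has one empty word) and n = 2 (words of length 1, so at most k of them); the other claims of (ii) are kept for all n. A one-word code is given minimum distance infinity. *)

theory Defs
  imports
    "HOL-Library.Extended_Real"
    "Jordan_Normal_Form.Schur_Decomposition"
begin

definition primitive_root_of_unity :: "nat \<Rightarrow> complex \<Rightarrow> bool" where
  "primitive_root_of_unity k \<zeta> \<longleftrightarrow> 0 < k \<and> \<zeta> ^ k = 1 \<and> (\<forall>j. 0 < j \<and> j < k \<longrightarrow> \<zeta> ^ j \<noteq> 1)"

definition roots_of_unity :: "nat \<Rightarrow> complex set" where
  "roots_of_unity k = {u. u ^ k = 1}"

definition butson_hadamard :: "nat \<Rightarrow> nat \<Rightarrow> complex mat \<Rightarrow> bool" where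
  "butson_hadamard n k H \<longleftrightarrow>
     H \<in> carrier_mat n n \<and> elements_mat H \<subseteq> roots_of_unity k \<and>
     H * mat_adjoint H = of_nat n \<cdot>\<^sub>m 1\<^sub>m n"

definition normalized :: "complex mat \<Rightarrow> bool" where
  "normalized H \<longleftrightarrow>
     (\<forall>j < dim_col H. H $$ (0, j) = 1) \<and> (\<forall>i < dim_row H. H $$ (i, 0) = 1)"

text \<open>The ring of integers modulo \<open>k\<close> is represented by its canonical residues \<open>{..<k}\<close>,
  so two elements are equal in it iff they are equal as natural numbers.
  If \<open>\<zeta>\<close> is a primitive \<open>k\<close>-th root of unity, every \<open>k\<close>-th root of unity has exactly one
  exponent in \<open>{..<k}\<close>, by the two lemmas below.\<close>

definition root_exponent :: "nat \<Rightarrow> complex \<Rightarrow> complex \<Rightarrow> nat" where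
  "root_exponent k \<zeta> x = (THE b. b < k \<and> \<zeta> ^ b = x)"

definition exponent_matrix :: "nat \<Rightarrow> complex \<Rightarrow> complex mat \<Rightarrow> nat mat" where
  "exponent_matrix k \<zeta> X = map_mat (root_exponent k \<zeta>) X"

lemma inj_on_power_primitive_root:
  assumes "primitive_root_of_unity k \<zeta>"
  shows "inj_on (\<lambda>b. \<zeta> ^ b) {..<k}"
proof (rule linorder_inj_onI)
  fix b c assume bc: "b < c" "b \<in> {..<k}" "c \<in> {..<k}"
  have "\<zeta> \<noteq> 0"
    using assms by (auto simp: primitive_root_of_unity_def power_0_left)
  moreover have "\<zeta> ^ c = \<zeta> ^ b * \<zeta> ^ (c - b)"
    using bc by (simp flip: power_add)
  moreover have "\<zeta> ^ (c - b) \<noteq> 1"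
    using assms bc by (auto simp: primitive_root_of_unity_def)
  ultimately show "\<zeta> ^ b \<noteq> \<zeta> ^ c"
    by simp
qed auto

lemma root_exponent_power:
  assumes "primitive_root_of_unity k \<zeta>"
  shows "root_exponent k \<zeta> (\<zeta> ^ m) = m mod k"
proof -
  have "k > 0" "\<zeta> ^ k = 1"
    using assms by (auto simp: primitive_root_of_unity_def)
  have "\<zeta> ^ m = \<zeta> ^ (k * (m div k) + m mod k)"
    by simp
  also have "\<dots> = \<zeta> ^ (m mod k)"
    unfolding power_add power_mult by (simp add: \<open>\<zeta> ^ k = 1\<close>)
  finally have "\<zeta> ^ (m mod k) = \<zeta> ^ m" ..
  then show ?thesis
    unfolding root_exponent_def using \<open>k > 0\<close> inj_on_power_primitive_root[OF assms]
    by (intro the_equality) (auto simp: inj_on_def)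
qed

lemma range_power_primitive_root:
  assumes "primitive_root_of_unity k \<zeta>"
  shows "(\<lambda>b. \<zeta> ^ b) ` {..<k} = roots_of_unity k"
proof (rule card_subset_eq)
  have k: "k > 0" "\<zeta> ^ k = 1"
    using assms by (auto simp: primitive_root_of_unity_def)
  show "finite (roots_of_unity k)"
    using k by (simp add: roots_of_unity_def finite_roots_unity Suc_le_eq)
  show sub: "(\<lambda>b. \<zeta> ^ b) ` {..<k} \<subseteq> roots_of_unity k"
    using k by (auto simp: roots_of_unity_def simp flip: power_mult)
       (metis mult.commute power_mult power_one)
  have "card ((\<lambda>b. \<zeta> ^ b) ` {..<k}) = k"
    using inj_on_power_primitive_root[OF assms] by (simp add: card_image)
  then show "card ((\<lambda>b. \<zeta> ^ b) ` {..<k}) = card (roots_of_unity k)"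
    using k by (simp add: roots_of_unity_def card_roots_unity_eq)
qed

definition delete_first_col :: "'a mat \<Rightarrow> 'a mat" where
  "delete_first_col A = mat (dim_row A) (dim_col A - 1) (\<lambda>(i, j). A $$ (i, j + 1))"

definition append_col :: "'a mat \<Rightarrow> 'a vec \<Rightarrow> 'a mat" where
  "append_col A v =
     mat (dim_row A) (dim_col A + 1) (\<lambda>(i, j). if j < dim_col A then A $$ (i, j) else v $ i)"

definition code_A :: "nat mat \<Rightarrow> nat vec set" where
  "code_A H' = set (rows (delete_first_col H'))"

definition code_B :: "nat \<Rightarrow> complex \<Rightarrow> complex mat \<Rightarrow> nat vec set" where
  "code_B k \<zeta> H =
     (\<Union>u \<in> roots_of_unity k. set (rows (delete_first_col (exponent_matrix k \<zeta> (u \<cdot>\<^sub>m H)))))"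

definition code_C :: "nat \<Rightarrow> complex \<Rightarrow> complex mat \<Rightarrow> nat vec set" where
  "code_C k \<zeta> H = (\<Union>u \<in> roots_of_unity k. set (rows (exponent_matrix k \<zeta> (u \<cdot>\<^sub>m H))))"

text \<open>In \<open>code_D\<close> the appended column is that of \<open>H\<close>, not that of \<open>u \<cdot>\<^sub>m H\<close>.\<close>

definition code_D :: "nat \<Rightarrow> complex \<Rightarrow> complex mat \<Rightarrow> nat \<Rightarrow> nat vec set" where
  "code_D k \<zeta> H c =
     (\<Union>u \<in> roots_of_unity k.
        set (rows (exponent_matrix k \<zeta> (append_col (u \<cdot>\<^sub>m H) (col H c)))))"

definition hamming_dist :: "'a vec \<Rightarrow> 'a vec \<Rightarrow> nat" where
  "hamming_dist v w = card {i. i < dim_vec v \<and> v $ i \<noteq> w $ i}"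

text \<open>For a code with at least two words the infimum below is an attained minimum, hence a
  natural number; for a code with a single word there are no pairs and it is \<open>\<infinity>\<close>.\<close>

definition min_distance :: "'a vec set \<Rightarrow> enat" where
  "min_distance C = Inf {enat (hamming_dist v w) | v w. v \<in> C \<and> w \<in> C \<and> v \<noteq> w}"

definition is_code :: "nat \<Rightarrow> nat \<Rightarrow> nat \<Rightarrow> enat \<Rightarrow> nat vec set \<Rightarrow> bool" where
  "is_code k m M d C \<longleftrightarrow>
     C \<noteq> {} \<and> C \<subseteq> {v \<in> carrier_vec m. set\<^sub>v v \<subseteq> {..<k}} \<and> card C = M \<and> min_distance C = d"

end

theory Submission
  imports Defs "HOL-Number_Theory.Cong"
begin

text \<open>Two rows of \<open>H\<close>, scaled by \<open>u\<close> and \<open>u'\<close>, agree exactly where the quotients of the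
  entries of the unscaled rows equal \<open>u' / u\<close>, and by orthogonality these \<open>n\<close> quotients are
  \<open>k\<close>-th roots of unity with sum \<open>0\<close>. So everything rests on the claim that in a vanishing sum
  of \<open>n\<close> \<open>k\<close>-th roots of unity each value occurs at most \<open>n / l\<close> times. Dividing by that value,
  we may take it to be \<open>1\<close>. Since the cyclotomic polynomial is irreducible, the relation
  persists when every root is raised to a power \<open>a\<close> prime to \<open>k\<close>. Adding these
  relations over all \<open>a\<close> turns each term into a Ramanujan sum, which is \<open>\<phi>(k)\<close> for the root \<open>1\<close>
  and at most \<open>\<phi>(k) / (l - 1)\<close> in absolute value for every other root.\<close>

section \<open>The Frobenius congruence for integer polynomials\<close>

text \<open>For \<open>0 < k < p\<close> the prime \<open>p\<close> divides
  \<open>p choose k\<close>, so modulo \<open>p\<close> only the two end terms of the binomial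
  expansion survive.\<close>

lemma prime_dvd_freshman:
  fixes a b :: "'a::comm_ring_1"
  assumes "prime p"
  shows "of_nat p dvd (a + b) ^ p - a ^ p - b ^ p"
proof -
  have p: "p > 1" using assms by (rule prime_gt_1_nat)
  have "(a + b) ^ p = (\<Sum>k\<le>p. of_nat (p choose k) * a ^ k * b ^ (p - k))"
    by (rule binomial_ring)
  also have "{..p} = insert 0 (insert p {1..<p})"
    using p by auto
  also have "(\<Sum>k\<in>\<dots>. of_nat (p choose k) * a ^ k * b ^ (p - k)) =
      b ^ p + a ^ p + (\<Sum>k\<in>{1..<p}. of_nat (p choose k) * a ^ k * b ^ (p - k))"
    using p by (simp add: add.assoc)
  finally have "(a + b) ^ p - a ^ p - b ^ p =
      (\<Sum>k\<in>{1..<p}. of_nat (p choose k) * a ^ k * b ^ (p - k))"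
    by simp
  also have "of_nat p dvd \<dots>"
  proof (intro dvd_sum dvd_mult2)
    fix k assume "k \<in> {1..<p}"
    then have "p dvd p choose k" using assms by (intro dvd_choose_prime) auto
    then show "(of_nat p :: 'a) dvd of_nat (p choose k)"
      by (metis dvd_def of_nat_mult)
  qed
  finally show ?thesis .
qed

text \<open>Fermat's little theorem, by induction on natural numbers via
  \<open>prime_dvd_freshman\<close>; passing to the residue \<open>a mod int p\<close> covers
  negative integers.\<close>

lemma prime_dvd_int_power_diff:
  fixes a :: int
  assumes "prime p"
  shows "int p dvd a ^ p - a"
proof -
  have nat: "int p dvd int m ^ p - int m" for m
  proof (induction m)
    case 0
    then show ?case using assms by (simp add: power_0_left prime_gt_0_nat)
  next
    case (Suc m)
    have "int p dvd (int m + 1) ^ p - int m ^ p - 1"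
      using prime_dvd_freshman[OF assms, of "int m" 1] by simp
    from dvd_add[OF this Suc] show ?case by (simp add: algebra_simps)
  qed
  define m where "m = nat (a mod int p)"
  have "[int m = a] (mod int p)"
    using assms by (simp add: m_def cong_def prime_gt_0_nat)
  then have "[int m ^ p - int m = a ^ p - a] (mod int p)"
    by (intro cong_diff cong_pow)
  then show ?thesis using nat cong_dvd_iff by blast
qed

text \<open>Modulo \<open>p\<close>, raising to the power \<open>p\<close> is additive and, by
  Fermat, fixes the coefficients, so it only replaces \<open>x\<close> by
  \<open>x^p\<close>.\<close>

lemma prime_dvd_pcompose_monom_diff_power:
  fixes f :: "int poly"
  assumes "prime p"
  shows "of_nat p dvd pcompose f (monom 1 p) - f ^ p"
proof (induction f)
  case 0
  then show ?case using assms by (simp add: power_0_left prime_gt_0_nat)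
next
  case (pCons a q)
  define P where "P = (of_nat p :: int poly)"
  define X where "X = (monom 1 p :: int poly)"
  have Xp: "monom 1 (Suc 0) ^ p = X" by (simp add: X_def monom_power)
  have eq: "pCons a q = [:a:] + monom 1 1 * q"
    by (simp add: monom_Suc)
  have 1: "P dvd pCons a q ^ p - [:a:] ^ p - (monom 1 1 * q) ^ p"
    unfolding eq P_def by (rule prime_dvd_freshman[OF assms])
  have "P dvd [:a ^ p - a:]"
    using prime_dvd_int_power_diff[OF assms, of a]
    by (simp add: P_def of_nat_poly const_poly_dvd)
  then have 2: "P dvd [:a:] ^ p - [:a:]"
    by (simp add: poly_const_pow)
  have 3: "P dvd X * (pcompose q X - q ^ p)"
    using pCons.IH by (simp add: P_def X_def)
  \<comment> \<open>The difference splits into the induction hypothesis times \<open>X\<close>, the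
    error of additivity and the Fermat error of the constant term.\<close>
  have "pcompose (pCons a q) X - pCons a q ^ p =
      X * (pcompose q X - q ^ p) - (pCons a q ^ p - [:a:] ^ p - (monom 1 1 * q) ^ p)
        - ([:a:] ^ p - [:a:])"
    by (simp add: pcompose_pCons power_mult_distrib Xp algebra_simps)
  also have "P dvd \<dots>" using dvd_diff[OF dvd_diff[OF 3 1] 2] .
  finally show ?case by (simp add: P_def X_def)
qed

section \<open>Minimal polynomials over the integers\<close>

text \<open>Gauss's lemma: content is multiplicative, so \<open>a\<close> divides the content of the
  cofactor of \<open>f\<close> and can be cancelled.\<close>

lemma primitive_dvd_smult_imp_dvd:
  fixes f g :: "int poly"
  assumes "content f = 1" "a \<noteq> 0" "f dvd smult a g"
  shows "f dvd g"
proof -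
  obtain q where q: "smult a g = f * q" using assms by (auto elim: dvdE)
  have "a dvd content (smult a g)" by simp
  also have "content (smult a g) = content q"
    using q assms by (simp add: content_mult)
  finally obtain r where "q = [:a:] * r"
    unfolding const_poly_dvd_iff_dvd_content[symmetric] by (auto elim: dvdE)
  then have "smult a g = smult a (f * r)" using q by simp
  then have "smult a (g - f * r) = 0" by (simp add: smult_diff_right)
  then show ?thesis using assms by simp
qed

text \<open>\<open>f\<close> is the primitive part of an annihilating polynomial of least degree.
  The pseudo-remainder modulo \<open>f\<close> vanishes at \<open>z\<close>, hence is zero by
  minimality, and the multiplier \<open>a\<close> cancels because \<open>f\<close> is
  primitive.\<close>

lemma minimal_int_poly:
  fixes z :: complex
  assumes "g0 \<noteq> 0" "poly (of_int_poly g0) z = 0"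
  obtains f :: "int poly" where "f \<noteq> 0" "poly (of_int_poly f) z = 0"
    "\<And>g. poly (of_int_poly g) z = 0 \<Longrightarrow> f dvd g"
    "\<And>g. poly (of_int_poly g) z = 0 \<Longrightarrow> degree g < degree f \<Longrightarrow> g = 0"
proof -
  define P where "P g \<longleftrightarrow> g \<noteq> 0 \<and> poly (of_int_poly g) z = 0" for g
  define h where "h = arg_min degree P"
  have h: "P h" "\<And>g. P g \<Longrightarrow> degree h \<le> degree g"
    using assms arg_min_natI[of P g0 degree] arg_min_nat_le[of P _ degree]
    by (auto simp: P_def h_def)
  define f where "f = primitive_part h"
  have hf: "h = smult (content h) f" by (simp add: f_def)
  have h0: "h \<noteq> 0" using h by (simp add: P_def)
  have f: "content f = 1" "f \<noteq> 0" "degree f = degree h"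
    using h0 by (auto simp: f_def)
  have "of_int (content h) * poly (of_int_poly f) z = 0"
    using h(1) hf unfolding P_def by (metis of_int_hom.map_poly_hom_smult poly_smult)
  then have fz: "poly (of_int_poly f) z = 0" using h0 by simp
  have small: "g = 0" if "poly (of_int_poly g) z = 0" "degree g < degree f" for g
    using that h(2)[of g] f by (force simp: P_def)
  have "f dvd g" if g: "poly (of_int_poly g) z = 0" for g
  proof -
    obtain a q where aq: "a \<noteq> 0" "smult a g = f * q + pseudo_mod g f"
      using pseudo_mod(1)[OF f(2)] by blast
    have "pseudo_mod g f = smult a g - f * q" using aq by simp
    then have "poly (of_int_poly (pseudo_mod g f)) z = 0"
      using g fz by (simp add: of_int_poly_hom.hom_minus of_int_hom.map_poly_hom_smult
          of_int_poly_hom.hom_mult)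
    then have "pseudo_mod g f = 0" using small pseudo_mod(2)[OF f(2)] by blast
    then show ?thesis using aq f primitive_dvd_smult_imp_dvd by (metis add.right_neutral dvd_triv_left)
  qed
  with that f(2) fz small show ?thesis by blast
qed


section \<open>Conjugation of primitive roots of unity\<close>

text \<open>\<open>k dvd a * j\<close> forces \<open>k dvd j\<close>, so the order stays
  \<open>k\<close>. This allows conjugation by one prime after another.\<close>

lemma primitive_root_of_unity_power:
  assumes "primitive_root_of_unity k z" "coprime a k"
  shows "primitive_root_of_unity k (z ^ a)"
proof -
  have k: "k > 0" "z ^ k = 1" using assms by (auto simp: primitive_root_of_unity_def)
  have "(z ^ a) ^ k = 1" using k by (metis mult.commute power_mult power_one)
  moreover have "(z ^ a) ^ j \<noteq> 1" if "0 < j" "j < k" for j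
  proof
    assume "(z ^ a) ^ j = 1"
    then have "root_exponent k z (z ^ (a * j)) = root_exponent k z (z ^ 0)"
      unfolding power_mult by simp
    then have "k dvd a * j"
      unfolding root_exponent_power[OF assms(1)] by (simp add: mod_eq_0_iff_dvd)
    then have "k dvd j" using assms(2) by (simp add: coprime_commute coprime_dvd_mult_right_iff)
    then show False using that by (auto dest: dvd_imp_le)
  qed
  ultimately show ?thesis using k by (simp add: primitive_root_of_unity_def)
qed

text \<open>Let \<open>f\<close> be the minimal polynomial of \<open>z\<close> and \<open>x^k - 1 = f h\<close>. Since \<open>f(z^p)\<close> lies in
  \<open>p\<int>[z]\<close>, differentiating shows that \<open>f(z^p) \<noteq> 0\<close> would put the prime-to-\<open>p\<close> integer \<open>k\<close>
  into \<open>p\<int>[z]\<close>.\<close>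

lemma int_poly_root_power_prime:
  fixes z :: complex and g :: "int poly"
  assumes z: "primitive_root_of_unity k z" and p: "prime p" "\<not> p dvd k"
    and g: "poly (of_int_poly g) z = 0"
  shows "poly (of_int_poly g) (z ^ p) = 0"
proof -
  define ev :: "int poly \<Rightarrow> complex \<Rightarrow> complex" where "ev q = poly (of_int_poly q)" for q
  have ev_simps: "ev (q + r) x = ev q x + ev r x" "ev (q - r) x = ev q x - ev r x"
    "ev (q * r) x = ev q x * ev r x" "ev (q ^ m) x = ev q x ^ m"
    "ev (smult c q) x = of_int c * ev q x" "ev [:c:] x = of_int c" "ev (monom c m) x = of_int c * x ^ m"
    "ev (of_nat m) x = of_nat m"
    "ev (pcompose q r) x = ev q (ev r x)"
    for q r x m c
    by (simp_all add: ev_def of_int_poly_hom.hom_add of_int_poly_hom.hom_minus of_int_poly_hom.hom_mult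
        of_int_poly_hom.hom_power of_int_hom.map_poly_hom_smult of_nat_poly poly_monom of_int_hom.map_poly_pCons_hom
        of_int_hom.map_poly_pcompose poly_pcompose)
  have k: "k > 0" "z ^ k = 1" using z by (auto simp: primitive_root_of_unity_def)
  define X where "X = (monom 1 k - [:1:] :: int poly)"
  have evX: "ev X x = x ^ k - 1" for x by (simp add: X_def ev_simps)
  have "coeff X k = 1" using k by (simp add: X_def coeff_pCons split: nat.splits)
  then have X0: "X \<noteq> 0" by auto
  have degX: "degree X = k" "lead_coeff X = 1"
  proof -
    show "degree X = k"
    proof (rule antisym)
      show "degree X \<le> k"
        unfolding X_def by (intro degree_diff_le degree_monom_le) simp
      show "k \<le> degree X" using \<open>coeff X k = 1\<close> by (intro le_degree) simp
    qed
    with \<open>coeff X k = 1\<close> show "lead_coeff X = 1" by simp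
  qed
  obtain f where f: "f \<noteq> 0" "ev f z = 0" "\<And>q. ev q z = 0 \<Longrightarrow> f dvd q"
    "\<And>q. ev q z = 0 \<Longrightarrow> degree q < degree f \<Longrightarrow> q = 0"
    using minimal_int_poly[of X z] X0 evX k unfolding ev_def by (metis right_minus_eq)
  obtain h where h: "X = f * h" using f(3) evX k by (metis dvdE right_minus_eq)
  \<comment> \<open>\<open>f\<close> divides the monic \<open>X\<close>, so its leading coefficient
    is a unit and pseudo-division by \<open>f\<close> below scales only by a unit.\<close>
  have lc: "lead_coeff f dvd 1" using degX h by (metis dvd_triv_left lead_coeff_mult)
  have degf: "degree f > 0"
  proof (rule ccontr)
    assume "\<not> degree f > 0"
    then obtain c where c: "f = [:c:]" using degree_eq_zeroE by blast
    then show False using f(1,2) by (simp add: ev_simps)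
  qed
  have f0: "ev f (z ^ p) = 0"
  proof (rule ccontr)
    assume nz: "ev f (z ^ p) \<noteq> 0"
    have zp: "(z ^ p) ^ k = 1" using k by (metis mult.commute power_mult power_one)
    have "ev f (z ^ p) * ev h (z ^ p) = 0"
      using evX[of "z ^ p"] zp h by (simp add: ev_simps)
    then have hz: "ev h (z ^ p) = 0" using nz by simp
    \<comment> \<open>\<open>X = f * h\<close> is differentiated and evaluated at
      \<open>z ^ p\<close>: as \<open>h\<close> vanishes there, only the term with
      \<open>pderiv h\<close> is left.\<close>
    have "pderiv X = smult (int k) (monom 1 (k - 1))"
      by (simp add: X_def pderiv_diff pderiv_monom smult_monom)
    moreover have "pderiv X = f * pderiv h + h * pderiv f"
      by (simp add: h pderiv_mult)
    ultimately have "of_nat k * (z ^ p) ^ (k - 1) = ev f (z ^ p) * ev (pderiv h) (z ^ p)"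
      using hz by (metis ev_simps(1,3,5,7) add.right_neutral mult_zero_left of_int_1 mult_1 of_int_of_nat_eq)
    then have "of_nat k * ((z ^ p) ^ (k - 1) * z ^ p) = ev f (z ^ p) * ev (pderiv h) (z ^ p) * z ^ p"
      by simp
    also have "(z ^ p) ^ (k - 1) * z ^ p = 1"
      using zp k by (metis power_minus_mult)
    finally have kz: "of_nat k = ev f (z ^ p) * ev (pderiv h) (z ^ p) * z ^ p" by simp
    \<comment> \<open>By the Frobenius congruence and \<open>ev f z = 0\<close>, the value of
      \<open>f\<close> at \<open>z ^ p\<close> is \<open>p\<close> times that of \<open>e\<close> at
      \<open>z\<close>.\<close>
    obtain e where e: "pcompose f (monom 1 p) - f ^ p = of_nat p * e"
      using prime_dvd_pcompose_monom_diff_power[OF p(1)] by (metis dvdE)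
    have "ev (pcompose f (monom 1 p) - f ^ p) z = ev f (z ^ p)"
      using f(2) p(1) by (simp add: ev_simps power_0_left prime_gt_0_nat)
    then have fe: "ev f (z ^ p) = of_nat p * ev e z" by (simp add: e ev_simps)
    \<comment> \<open>\<open>b\<close> gathers all cofactors, with \<open>x^p\<close> substituted,
      so that \<open>k\<close> is \<open>p\<close> times the value of \<open>b\<close> at
      \<open>z\<close>.\<close>
    define b where "b = e * pcompose (pderiv h) (monom 1 p) * monom 1 p"
    have b: "of_nat k = of_nat p * ev b z"
      unfolding kz fe b_def by (simp add: ev_simps)
    \<comment> \<open>Reduction modulo \<open>f\<close> replaces \<open>b\<close> by
      \<open>r\<close>, of degree below that of \<open>f\<close>; \<open>w\<close> undoes the unit
      \<open>u\<close>.\<close>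
    obtain q r where qr: "pseudo_divmod b f = (q, r)" by fastforce
    define u where "u = lead_coeff f ^ (Suc (degree b) - degree f)"
    have u: "u dvd 1" unfolding u_def using lc by (metis dvd_power_same power_one)
    then obtain w where w: "u * w = 1" by (metis dvdE)
    have bq: "smult u b = f * q + r" "r = 0 \<or> degree r < degree f"
      using pseudo_divmod[OF f(1) qr] by (auto simp: u_def)
    have "of_int u * ev b z = ev r z"
      using arg_cong[OF bq(1), of "\<lambda>q. ev q z"] f(2) by (simp add: ev_simps)
    then have "of_int w * ev r z = of_int (u * w) * ev b z" by simp
    then have "of_nat k = of_nat p * (of_int w * ev r z)" using b w by simp
    \<comment> \<open>Below \<open>degree f\<close> a relation at \<open>z\<close> is a polynomial
      identity; comparing constant coefficients gives \<open>p dvd k\<close>.\<close>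
    then have "ev (smult (int p * w) r - [:int k:]) z = 0"
      by (simp add: ev_simps)
    moreover have "degree (smult (int p * w) r - [:int k:]) < degree f"
      using bq(2) degf by (intro degree_diff_less) auto
    ultimately have "smult (int p * w) r - [:int k:] = 0" by (rule f(4))
    then have "coeff (smult (int p * w) r) 0 = int k" by (simp only: right_minus_eq) simp
    then have "int p dvd int k" by (metis coeff_smult dvd_triv_left mult.assoc)
    then show False using p(2) by simp
  qed
  obtain q where "g = f * q" using f(3) g unfolding ev_def by (metis dvdE)
  then have "ev g (z ^ p) = 0" using f0 by (simp add: ev_simps)
  then show ?thesis by (simp add: ev_def)
qed

text \<open>Induction over the prime factors of \<open>a\<close>; \<open>z\<close> varies because
  the induction hypothesis is applied to the primitive root \<open>z ^ p\<close>.\<close>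

lemma int_poly_root_power_coprime:
  fixes z :: complex and g :: "int poly"
  assumes "primitive_root_of_unity k z" "coprime a k" "poly (of_int_poly g) z = 0" "a > 0"
  shows "poly (of_int_poly g) (z ^ a) = 0"
  using assms
proof (induction a arbitrary: z rule: prime_divisors_induct)
  case (factor p a)
  then have *: "coprime p k" "coprime a k" "a > 0" by auto
  then have "\<not> p dvd k" using factor.hyps by (metis coprime_absorb_left not_prime_unit)
  then have "poly (of_int_poly g) (z ^ p) = 0"
    using factor by (intro int_poly_root_power_prime) auto
  then have "poly (of_int_poly g) ((z ^ p) ^ a) = 0"
    using factor.IH[of "z ^ p"] factor.prems * primitive_root_of_unity_power by blast
  then show ?case by (simp add: power_mult)
qed auto

section \<open>Vanishing sums of roots of unity\<close>

text \<open>For \<open>p\<close> prime and \<open>k = p^v k2\<close> with \<open>k2\<close> prime to \<open>p\<close> and \<open>w^k2 \<noteq> 1\<close>, the sum of \<open>w^a\<close> over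
  the \<open>a\<close> prime to \<open>k2\<close> is invariant under multiplication by \<open>w^k2\<close>, hence vanishes. So the sum
  over the units equals, up to sign, the sum over the multiples of \<open>p\<close> prime to \<open>k2\<close>, of which
  there are at most \<open>1/(p - 1)\<close> times as many as units.\<close>

lemma norm_ramanujan_sum_le:
  fixes z :: complex
  defines "R \<equiv> \<lambda>k. {a::nat. a < k \<and> coprime a k}"
  assumes z: "primitive_root_of_unity k z" and b: "\<not> k dvd b"
    and l: "\<And>p. prime p \<Longrightarrow> p dvd k \<Longrightarrow> l \<le> p"
  shows "norm (\<Sum>a\<in>R k. (z ^ b) ^ a) * (real l - 1) \<le> real (card (R k))"
proof -
  have k: "k > 0" "z ^ k = 1" using z by (auto simp: primitive_root_of_unity_def)
  have b0: "b \<noteq> 0" using b by (metis dvd_0_right)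
  define w where "w = z ^ b"
  have wmod: "w ^ (m mod k) = w ^ m" for m
  proof -
    have "w ^ k = 1" unfolding w_def using k by (metis mult.commute power_mult power_one)
    have "w ^ m = w ^ (k * (m div k) + m mod k)" by simp
    also have "\<dots> = w ^ (m mod k)"
      unfolding power_add power_mult by (simp add: \<open>w ^ k = 1\<close>)
    finally show ?thesis ..
  qed
  \<comment> \<open>As \<open>k\<close> does not divide \<open>b\<close>, some prime occurs in
    \<open>k\<close> more often than in \<open>b\<close>; \<open>k2\<close> contributes no factor
    \<open>p\<close>, whence \<open>w ^ k2 \<noteq> 1\<close> below.\<close>
  obtain p where p: "prime p" "multiplicity p b < multiplicity p k"
    using b b0 k multiplicity_le_imp_dvd[of k b] by (metis not_le not_gr0)
  obtain k2 where k2: "k = p ^ multiplicity p k * k2" "\<not> p dvd k2"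
    using k p by (metis multiplicity_decompose' not_prime_unit neq0_conv)
  define v where "v = multiplicity p k"
  have v: "v > 0" "k = p ^ v * k2" using p k2 by (auto simp: v_def)
  then have pk: "p dvd k" "k2 dvd k" by auto
  have k20: "k2 > 0" using v k by (auto intro: ccontr)
  have "\<not> k dvd b * k2"
  proof
    assume "k dvd b * k2"
    then have "multiplicity p k \<le> multiplicity p (b * k2)"
      using b0 k20 by (intro dvd_imp_multiplicity_le) auto
    also have "\<dots> = multiplicity p b"
      using b0 k20 p k2 by (simp add: prime_elem_multiplicity_mult_distrib not_dvd_imp_multiplicity_0)
    finally show False using p by simp
  qed
  have wk2: "w ^ k2 \<noteq> 1"
  proof
    assume "w ^ k2 = 1"
    then have "root_exponent k z (z ^ (b * k2)) = root_exponent k z (z ^ 0)"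
      unfolding power_mult w_def by simp
    then show False using \<open>\<not> k dvd b * k2\<close>
      unfolding root_exponent_power[OF z] by (simp add: mod_eq_0_iff_dvd)
  qed
  \<comment> \<open>\<open>S\<close> drops the condition at \<open>p\<close>, which makes it
    invariant under adding \<open>k2\<close> modulo \<open>k\<close>; \<open>R k\<close> is
    \<open>S\<close> without \<open>P\<close>.\<close>
  define S where "S = {a. a < k \<and> coprime a k2}"
  define P where "P = {a \<in> S. p dvd a}"
  have fin: "finite S" "finite P" "finite (R k)" by (auto simp: S_def P_def R_def)
  have cop: "coprime ((a + t * k2) mod k) k2 \<longleftrightarrow> coprime a k2" for a t
    by (metis coprime_mod_left_iff mod_mod_cancel mod_mult_self1 pk(2) k20 neq0_conv)
  have Rk: "a \<in> R k \<longleftrightarrow> a \<in> S \<and> \<not> p dvd a" for a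
    using v p(1) by (auto simp: R_def S_def coprime_commute[of a] prime_imp_coprime
        prime_imp_power_coprime)
  have "inj_on (\<lambda>a. (a + 1 * k2) mod k) S"
  proof (rule inj_onI)
    fix x y assume "x \<in> S" "y \<in> S" "(x + 1 * k2) mod k = (y + 1 * k2) mod k"
    then have "[x + k2 = y + k2] (mod k)" "x < k" "y < k" by (auto simp: cong_def S_def)
    then show "x = y" by (metis cong_add_rcancel_nat cong_less_modulus_unique_nat)
  qed
  moreover have "(\<lambda>a. (a + 1 * k2) mod k) ` S \<subseteq> S"
    using k cop[of _ 1] by (auto simp: S_def)
  ultimately have bij: "(\<lambda>a. (a + 1 * k2) mod k) ` S = S" "inj_on (\<lambda>a. (a + 1 * k2) mod k) S"
    by (metis endo_inj_surj fin(1)) fact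
  have "(\<Sum>a\<in>S. w ^ a) = (\<Sum>a\<in>S. w ^ ((a + 1 * k2) mod k))"
    using sum.reindex[OF bij(2), of "\<lambda>a. w ^ a"] bij(1) by simp
  also have "\<dots> = w ^ k2 * (\<Sum>a\<in>S. w ^ a)"
    by (simp add: wmod power_add sum_distrib_left mult.commute)
  finally have "(\<Sum>a\<in>S. w ^ a) = 0" using wk2 by simp
  moreover have "S = R k \<union> P" "R k \<inter> P = {}" using Rk by (auto simp: P_def)
  ultimately have "(\<Sum>a\<in>R k. w ^ a) + (\<Sum>a\<in>P. w ^ a) = 0"
    using fin by (simp add: sum.union_disjoint)
  then have "norm (\<Sum>a\<in>R k. w ^ a) = norm (\<Sum>a\<in>P. w ^ a)"
    by (metis add_eq_0_iff norm_minus_cancel)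
  also have "\<dots> \<le> (\<Sum>a\<in>P. norm (w ^ a))" by (rule norm_sum)
  also have "\<dots> = real (card P)"
  proof -
    have "norm z = 1" using power_eq_1_iff[OF k(2)] k(1) by simp
    then show ?thesis by (simp add: w_def norm_power)
  qed
  finally have le: "norm (\<Sum>a\<in>R k. w ^ a) \<le> real (card P)" .
  \<comment> \<open>Each \<open>a\<close> in \<open>P\<close> yields \<open>p - 1\<close> residues
    \<open>a + t * k2\<close> in \<open>R k\<close>: modulo \<open>p\<close> they equal
    \<open>t * k2\<close>, which is nonzero and determines \<open>t\<close>, and then
    \<open>a\<close> is determined modulo \<open>k\<close>.\<close>
  have "card (P \<times> {1..<p}) \<le> card (R k)"
  proof (rule card_inj_on_le)
    show "inj_on (\<lambda>(a, t). (a + t * k2) mod k) (P \<times> {1..<p})"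
    proof (rule inj_onI, clarify)
      fix a t a' t'
      assume a: "a \<in> P" "a' \<in> P" and t: "t \<in> {1..<p}" "t' \<in> {1..<p}"
        and "(a + t * k2) mod k = (a' + t' * k2) mod k"
      then have eq: "[a + t * k2 = a' + t' * k2] (mod k)" by (simp add: cong_def)
      then have "[a + t * k2 = a' + t' * k2] (mod p)" using pk cong_dvd_modulus_nat by blast
      moreover have "[a + t * k2 = t * k2] (mod p)" "[a' + t' * k2 = t' * k2] (mod p)"
        using a by (auto simp: P_def cong_def mod_add_left_eq[symmetric] dest: dvd_imp_mod_0)
      ultimately have "[t * k2 = t' * k2] (mod p)" by (metis cong_sym cong_trans)
      moreover have "coprime k2 p" using p k2 by (metis prime_imp_coprime coprime_commute)
      ultimately have "[t = t'] (mod p)" by (simp add: cong_mult_rcancel_nat)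
      then have tt: "t = t'" using t by (auto intro: cong_less_modulus_unique_nat)
      then have "[a = a'] (mod k)" using eq by (simp add: cong_add_rcancel_nat)
      then have "a = a'" using a by (auto simp: P_def S_def intro: cong_less_modulus_unique_nat)
      with tt show "a = a' \<and> t = t'" by simp
    qed
    show "(\<lambda>(a, t). (a + t * k2) mod k) ` (P \<times> {1..<p}) \<subseteq> R k"
    proof clarify
      fix a t assume a: "a \<in> P" and t: "t \<in> {1..<p}"
      have "\<not> p dvd t" using t by (auto dest: dvd_imp_le)
      then have "\<not> p dvd t * k2" using p k2 by (simp add: prime_dvd_mult_iff)
      then have "\<not> p dvd (a + t * k2) mod k"
        using a pk by (simp add: P_def dvd_mod_iff dvd_add_right_iff)
      then show "(a + t * k2) mod k \<in> R k"
        using a k cop[of a t] by (simp add: Rk S_def P_def)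
    qed
  qed (rule fin)
  then have "real (card P) * real (p - 1) \<le> real (card (R k))"
    unfolding card_cartesian_product by (simp flip: of_nat_mult)
  moreover have "real l - 1 \<le> real (p - 1)" using l[OF p(1) pk(1)] p(1)
    by (simp add: of_nat_diff prime_ge_1_nat)
  \<comment> \<open>For \<open>l = 0\<close> the factor \<open>real l - 1\<close> is negative, so
    monotonicity fails, but then the left side is at most 0.\<close>
  moreover have "norm (\<Sum>a\<in>R k. w ^ a) * (real l - 1) \<le> real (card P) * real (p - 1)"
  proof (cases "l = 0")
    case True
    then show ?thesis by (auto intro: order_trans[of _ 0])
  next
    case False
    then show ?thesis using le \<open>real l - 1 \<le> real (p - 1)\<close> by (intro mult_mono) auto
  qed
  ultimately show ?thesis by (simp add: w_def)
qed

text \<open>After division by \<open>c\<close>, each term equal to \<open>c\<close> contributes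
  \<open>card R\<close> to the sum of the conjugate relations, and each other term a number whose
  norm times \<open>l - 1\<close> is at most \<open>card R\<close>. Hence
  \<open>(l - 1) * card M \<le> card J - card M\<close>, where \<open>M\<close> collects the
  positions of \<open>c\<close>.\<close>

lemma card_eq_const_le_of_vanishing_sum:
  fixes x :: "'a \<Rightarrow> complex"
  assumes z: "primitive_root_of_unity k z" and k: "k \<ge> 2"
    and l: "\<And>p. prime p \<Longrightarrow> p dvd k \<Longrightarrow> l \<le> p"
    and J: "finite J" "\<And>j. j \<in> J \<Longrightarrow> x j \<in> roots_of_unity k" and sum: "(\<Sum>j\<in>J. x j) = 0"
  shows "l * card {j \<in> J. x j = c} \<le> card J"
proof (cases "{j \<in> J. x j = c} = {}")
  case True
  then show ?thesis by (simp only: card.empty)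
next
  case False
  then have c: "c \<in> roots_of_unity k" using J by auto
  then have c0: "c \<noteq> 0" using k by (auto simp: roots_of_unity_def power_0_left)
  \<comment> \<open>With exponents below \<open>k\<close>, the value \<open>c\<close> corresponds to
    exponent 0 exactly.\<close>
  have "\<exists>e<k. x j = c * z ^ e" if "j \<in> J" for j
  proof -
    have "x j / c \<in> roots_of_unity k"
      using J(2)[OF that] c by (simp add: roots_of_unity_def power_divide)
    then obtain e where "e < k" "z ^ e = x j / c"
      using range_power_primitive_root[OF z] by (metis imageE lessThan_iff)
    then show ?thesis using c0 by (intro exI[of _ e]) simp
  qed
  then obtain e where e: "\<And>j. j \<in> J \<Longrightarrow> e j < k" "\<And>j. j \<in> J \<Longrightarrow> x j = c * z ^ e j"
    by metis
  define M where "M = {j \<in> J. x j = c}"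
  have M: "j \<in> M \<longleftrightarrow> e j = 0" if "j \<in> J" for j
  proof -
    have "x j = c \<longleftrightarrow> z ^ e j = 1" using e(2)[OF that] c0 by simp
    also have "\<dots> \<longleftrightarrow> e j = 0"
      using z e(1)[OF that] by (auto simp: primitive_root_of_unity_def)
    finally show ?thesis using that by (simp add: M_def)
  qed
  have MJ: "M \<subseteq> J" "finite M" using J by (auto simp: M_def)
  \<comment> \<open>The value of \<open>g\<close> at \<open>z ^ a\<close> is the normalized sum with
    every root raised to the power \<open>a\<close>.\<close>
  define g :: "int poly" where "g = (\<Sum>j\<in>J. monom 1 (e j))"
  have g: "poly (of_int_poly g) y = (\<Sum>j\<in>J. y ^ e j)" for y :: complex
    by (simp add: g_def of_int_poly_hom.hom_sum poly_sum poly_monom)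
  have "c * (\<Sum>j\<in>J. z ^ e j) = 0" using sum e by (simp add: sum_distrib_left)
  then have g0: "poly (of_int_poly g) z = 0" using c0 by (simp add: g)
  define R where "R = {a. a < k \<and> coprime a k}"
  have R: "finite R" "1 \<in> R" using k by (auto simp: R_def)
  define C where "C j = (\<Sum>a\<in>R. (z ^ e j) ^ a)" for j
  have "(\<Sum>j\<in>J. (z ^ e j) ^ a) = 0" if "a \<in> R" for a
  proof -
    have "a > 0" using that k by (auto simp: R_def intro: Nat.gr0I)
    then have "poly (of_int_poly g) (z ^ a) = 0"
      using that by (intro int_poly_root_power_coprime[OF z _ g0]) (auto simp: R_def)
    then show ?thesis by (simp add: g mult.commute flip: power_mult)
  qed
  then have "(\<Sum>j\<in>J. C j) = 0" unfolding C_def by (subst sum.swap) simp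
  also have "(\<Sum>j\<in>J. C j) = (\<Sum>j\<in>J - M. C j) + (\<Sum>j\<in>M. C j)"
    using J MJ by (simp add: sum.subset_diff)
  also have "(\<Sum>j\<in>M. C j) = of_nat (card M * card R)"
  proof -
    have "C j = of_nat (card R)" if "j \<in> M" for j
      using M that MJ(1) by (auto simp: C_def)
    then show ?thesis by simp
  qed
  finally have "norm (of_nat (card M * card R) :: complex) = norm (\<Sum>j\<in>J - M. C j)"
    by (metis add_eq_0_iff norm_minus_cancel)
  then have "real (card M * card R) = norm (\<Sum>j\<in>J - M. C j)" by (simp only: norm_of_nat)
  also have "\<dots> \<le> (\<Sum>j\<in>J - M. norm (C j))" by (rule norm_sum)
  finally have 1: "real (card M * card R) \<le> (\<Sum>j\<in>J - M. norm (C j))" .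
  show ?thesis
  proof (cases "l = 0")
    case False
    then have "real (card M * card R) * (real l - 1) \<le> (\<Sum>j\<in>J - M. norm (C j)) * (real l - 1)"
      using 1 by (intro mult_right_mono) auto
    also have "\<dots> = (\<Sum>j\<in>J - M. norm (C j) * (real l - 1))"
      by (rule sum_distrib_right)
    also have "\<dots> \<le> (\<Sum>j\<in>J - M. real (card R))"
    proof (rule sum_mono)
      fix j assume "j \<in> J - M"
      then have "e j < k" "e j > 0" using e(1) M by auto
      then have "\<not> k dvd e j" by (auto dest: dvd_imp_le)
      then show "norm (C j) * (real l - 1) \<le> real (card R)"
        unfolding C_def R_def using norm_ramanujan_sum_le[OF z _ l] by blast
    qed
    also have "\<dots> = (real (card J) - real (card M)) * real (card R)"
      using MJ J by (simp add: card_Diff_subset of_nat_diff card_mono)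
    finally have "real (card R) * (real l * real (card M)) \<le> real (card R) * real (card J)"
      by (simp add: algebra_simps)
    moreover have "card R > 0" using R by (auto simp: card_gt_0_iff)
    ultimately have "real (l * card M) \<le> real (card J)" by simp
    then show ?thesis unfolding M_def by linarith
  qed simp
qed

section \<open>Minimum distance of indexed codes\<close>

text \<open>The infimum of a nonempty set of \<open>enat\<close> is attained; without two distinct
  words it is infinite and the bound is trivial.\<close>

lemma ereal_le_min_distance:
  assumes "\<And>v w. v \<in> C \<Longrightarrow> w \<in> C \<Longrightarrow> v \<noteq> w \<Longrightarrow> r \<le> real (hamming_dist v w)"
  shows "ereal r \<le> ereal_of_enat (min_distance C)"
proof (cases "\<exists>v\<in>C. \<exists>w\<in>C. v \<noteq> w")
  case True
  define D where "D = {enat (hamming_dist v w) | v w. v \<in> C \<and> w \<in> C \<and> v \<noteq> w}"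
  have "D \<noteq> {}" using True by (auto simp: D_def)
  then have "Inf D \<in> D" by (auto simp: Inf_enat_def intro: LeastI)
  then obtain v w where "min_distance C = enat (hamming_dist v w)" "v \<in> C" "w \<in> C" "v \<noteq> w"
    by (auto simp: min_distance_def D_def)
  with assms[of v w] show ?thesis by simp
next
  case False
  then have "{enat (hamming_dist v w) | v w. v \<in> C \<and> w \<in> C \<and> v \<noteq> w} = {}" by blast
  then show ?thesis by (simp add: min_distance_def Inf_enat_def)
qed

text \<open>A positive distance bound makes the indexing injective, so words can be counted by
  indices. The guard \<open>r > 0\<close> keeps the lemma applicable to \<open>B_k\<close> for small
  \<open>n\<close>, where the bound may be nonpositive.\<close>

lemma is_code_image:
  assumes "finite I" "I \<noteq> {}"
    and W: "\<And>i. i \<in> I \<Longrightarrow> W i \<in> carrier_vec m" "\<And>i. i \<in> I \<Longrightarrow> set\<^sub>v (W i) \<subseteq> {..<k}"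
    and r: "\<And>i j. i \<in> I \<Longrightarrow> j \<in> I \<Longrightarrow> i \<noteq> j \<Longrightarrow> r \<le> real (hamming_dist (W i) (W j))"
  shows "\<exists>M d. is_code k m M d (W ` I) \<and> (r > 0 \<longrightarrow> M = card I) \<and> ereal_of_enat d \<ge> ereal r"
proof (intro exI conjI impI)
  show "is_code k m (card (W ` I)) (min_distance (W ` I)) (W ` I)"
    using assms by (auto simp: is_code_def)
  show "ereal r \<le> ereal_of_enat (min_distance (W ` I))"
    using r by (intro ereal_le_min_distance) blast
  show "card (W ` I) = card I" if "r > 0"
  proof (rule card_image, rule inj_onI, rule ccontr)
    fix i j assume ij: "i \<in> I" "j \<in> I" "W i = W j" "i \<noteq> j"
    have "hamming_dist (W j) (W j) = 0" by (simp add: hamming_dist_def)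
    then show False using r[OF ij(1,2,4)] ij(3) that by simp
  qed
qed

lemma hamming_dist_vec: "hamming_dist (vec m f) (vec m g) = card {j. j < m \<and> f j \<noteq> g j}"
  unfolding hamming_dist_def by (intro arg_cong[where f = card]) auto

text \<open>Deleting coordinate 0 costs one disagreement or none; this is the difference between the
  bounds for \<open>B_k\<close> and \<open>A_k\<close>.\<close>

lemma card_neq_Suc:
  fixes f g :: "nat \<Rightarrow> 'a"
  assumes "n \<ge> 1"
  shows "card {j. j < n \<and> f j \<noteq> g j} =
    (if f 0 = g 0 then 0 else 1) + card {j. j < n - 1 \<and> f (j + 1) \<noteq> g (j + 1)}"
proof -
  define T where "T = {j. j < n - 1 \<and> f (j + 1) \<noteq> g (j + 1)}"
  define Z :: "nat set" where "Z = (if f 0 = g 0 then {} else {0})"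
  have "j \<in> {j. j < n \<and> f j \<noteq> g j} \<longleftrightarrow> j \<in> Z \<union> Suc ` T" for j
    using assms by (cases j) (auto simp: T_def Z_def image_iff)
  then have "{j. j < n \<and> f j \<noteq> g j} = Z \<union> Suc ` T" by blast
  moreover have "card (Z \<union> Suc ` T) = card Z + card (Suc ` T)"
    by (rule card_Un_disjoint) (auto simp: T_def Z_def)
  moreover have "card (Suc ` T) = card T" by (simp add: card_image)
  moreover have "card Z = (if f 0 = g 0 then 0 else 1)" by (simp add: Z_def)
  ultimately show ?thesis by (simp only: T_def)
qed

section \<open>Agreements between scaled rows of a Butson-Hadamard matrix\<close>

lemma root_exponent_less:
  assumes "primitive_root_of_unity k \<zeta>" "x \<in> roots_of_unity k"
  shows "root_exponent k \<zeta> x < k"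
proof -
  obtain b where "x = \<zeta> ^ b" using assms range_power_primitive_root by blast
  then show ?thesis using assms by (simp add: root_exponent_power primitive_root_of_unity_def)
qed

lemma power_root_exponent:
  assumes "primitive_root_of_unity k \<zeta>" "x \<in> roots_of_unity k"
  shows "\<zeta> ^ root_exponent k \<zeta> x = x"
proof -
  obtain b where "b < k" "x = \<zeta> ^ b" using assms range_power_primitive_root by blast
  then show ?thesis using assms by (simp add: root_exponent_power)
qed

lemma roots_of_unity_mult: "u \<in> roots_of_unity k \<Longrightarrow> x \<in> roots_of_unity k \<Longrightarrow> u * x \<in> roots_of_unity k"
  by (simp add: roots_of_unity_def power_mult_distrib)

lemma butson_hadamard_entry:
  assumes "butson_hadamard n k H" "i < n" "j < n"
  shows "H $$ (i, j) \<in> roots_of_unity k"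
proof -
  have "H \<in> carrier_mat n n" "elements_mat H \<subseteq> roots_of_unity k"
    using assms by (auto simp: butson_hadamard_def)
  then show ?thesis using elements_matI[of H n n i j] assms by blast
qed

lemma butson_hadamard_rows_orthogonal:
  assumes H: "butson_hadamard n k H" and i: "i < n" "i' < n" "i \<noteq> i'"
  shows "(\<Sum>j<n. H $$ (i, j) * cnj (H $$ (i', j))) = 0"
proof -
  have dim: "H \<in> carrier_mat n n" and eq: "H * mat_adjoint H = of_nat n \<cdot>\<^sub>m 1\<^sub>m n"
    using H by (auto simp: butson_hadamard_def)
  have adj: "mat_adjoint H \<in> carrier_mat n n"
    using dim by (auto simp: mat_adjoint_def)
  have entry: "mat_adjoint H $$ (j, i') = cnj (H $$ (i', j))" if "j < n" for j
    using that dim i by (simp add: mat_adjoint_def mat_of_rows_index)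
  have "(H * mat_adjoint H) $$ (i, i') = row H i \<bullet> col (mat_adjoint H) i'"
    using dim adj i by (intro index_mult_mat) auto
  also have "\<dots> = (\<Sum>j<n. row H i $ j * col (mat_adjoint H) i' $ j)"
    using adj by (simp add: scalar_prod_def atLeast0LessThan)
  also have "\<dots> = (\<Sum>j<n. H $$ (i, j) * cnj (H $$ (i', j)))"
    using dim adj i entry by (intro sum.cong) auto
  finally have "(of_nat n \<cdot>\<^sub>m 1\<^sub>m n) $$ (i, i') = (\<Sum>j<n. H $$ (i, j) * cnj (H $$ (i', j)))"
    unfolding eq .
  moreover have "(of_nat n \<cdot>\<^sub>m 1\<^sub>m n :: complex mat) $$ (i, i') = 0"
    using i by simp
  ultimately show ?thesis by (rule trans[OF sym])
qed

text \<open>One row scaled by distinct units never agrees with itself, its entries being nonzero.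
  For distinct rows, conjugates are inverses, so an agreement at \<open>j\<close> forces the
  \<open>j\<close>-th term of their inner product to be \<open>u' / u\<close>, and the inner product
  vanishes.\<close>

lemma card_exponent_agreements_le:
  assumes z: "primitive_root_of_unity k \<zeta>" and k: "k \<ge> 2"
    and l: "\<And>p. prime p \<Longrightarrow> p dvd k \<Longrightarrow> l \<le> p"
    and H: "butson_hadamard n k H"
    and u: "u \<in> roots_of_unity k" "u' \<in> roots_of_unity k"
    and i: "i < n" "i' < n" and ne: "(u, i) \<noteq> (u', i')"
  shows "l * card {j. j < n \<and> root_exponent k \<zeta> (u * H $$ (i, j)) =
    root_exponent k \<zeta> (u' * H $$ (i', j))} \<le> n"
proof -
  define A where "A = {j. j < n \<and> root_exponent k \<zeta> (u * H $$ (i, j)) =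
    root_exponent k \<zeta> (u' * H $$ (i', j))}"
  have nz: "x \<noteq> 0" "x * cnj x = 1" "cnj x \<in> roots_of_unity k" if "x \<in> roots_of_unity k" for x
  proof -
    have xk: "x ^ k = 1" using that by (simp add: roots_of_unity_def)
    show "x \<noteq> 0" using xk k by (auto simp: power_0_left)
    have "norm x = 1"
      using power_eq_1_iff[OF xk] k by simp
    then show "x * cnj x = 1" by (simp add: complex_norm_square[symmetric])
    show "cnj x \<in> roots_of_unity k"
      using xk by (simp add: roots_of_unity_def flip: complex_cnj_power)
  qed
  have Hr: "H $$ (i, j) \<in> roots_of_unity k" "H $$ (i', j) \<in> roots_of_unity k" if "j < n" for j
    using that i butson_hadamard_entry[OF H] by auto
  have agree: "u * H $$ (i, j) = u' * H $$ (i', j)" if "j \<in> A" for j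
  proof -
    have "j < n" and eq: "root_exponent k \<zeta> (u * H $$ (i, j)) = root_exponent k \<zeta> (u' * H $$ (i', j))"
      using that by (auto simp: A_def)
    then have "u * H $$ (i, j) \<in> roots_of_unity k" "u' * H $$ (i', j) \<in> roots_of_unity k"
      using u Hr by (auto intro: roots_of_unity_mult)
    from this[THEN power_root_exponent[OF z]] eq show ?thesis by metis
  qed
  show ?thesis
  proof (cases "i = i'")
    case True
    have "A = {}"
    proof (rule ccontr)
      assume "A \<noteq> {}"
      then obtain j where j: "j \<in> A" by blast
      then have "H $$ (i, j) \<noteq> 0" using Hr(1)[THEN nz(1)] by (simp add: A_def)
      then show False using agree[OF j] True ne by simp
    qed
    then show ?thesis by (simp add: A_def[symmetric])
  next
    case False
    define x where "x j = H $$ (i, j) * cnj (H $$ (i', j))" for j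
    have "x j = u' / u" if j: "j \<in> A" for j
    proof -
      have "j < n" using j by (simp add: A_def)
      have "u * x j = u' * (H $$ (i', j) * cnj (H $$ (i', j)))"
        unfolding x_def using agree[OF j] by (metis mult.assoc)
      also have "\<dots> = u'" using nz(2)[OF Hr(2)[OF \<open>j < n\<close>]] by simp
      finally show ?thesis using nz(1)[OF u(1)] by (simp add: field_simps)
    qed
    then have "A \<subseteq> {j \<in> {..<n}. x j = u' / u}" by (auto simp: A_def)
    then have "card A \<le> card {j \<in> {..<n}. x j = u' / u}" by (intro card_mono) auto
    moreover have "l * card {j \<in> {..<n}. x j = u' / u} \<le> card {..<n}"
    proof (rule card_eq_const_le_of_vanishing_sum[OF z k l])
      show "x j \<in> roots_of_unity k" if "j \<in> {..<n}" for j
        unfolding x_def using that by (intro roots_of_unity_mult nz(3) Hr) auto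
      show "(\<Sum>j<n. x j) = 0"
        using butson_hadamard_rows_orthogonal[OF H i False] by (simp add: x_def)
    qed auto
    ultimately have "l * card A \<le> n"
      by (metis card_lessThan le_trans mult_le_mono2)
    then show ?thesis by (simp only: A_def)
  qed
qed

section \<open>The parameters of the four codes\<close>

text \<open>The words of \<open>B_k\<close> are a single empty word for \<open>n = 1\<close> and at
  most \<open>k\<close> words of length 1 for \<open>n = 2\<close>, fewer than \<open>n * k\<close>;
  so its size is asserted from \<open>n = 3\<close> on. Columns are counted from 0, so the
  noninitial ones are \<open>{1..<n}\<close>.\<close>

theorem theorem2:
  fixes n k l :: nat and \<zeta> :: complex and H :: "complex mat" and H' :: "nat mat"
  assumes "n \<ge> 1" and "k \<ge> 2"
    and "primitive_root_of_unity k \<zeta>"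
    and "H' \<in> carrier_mat n n" and "elements_mat H' \<subseteq> {..<k}"
    and "H = map_mat (\<lambda>a. \<zeta> ^ a) H'"
    and "butson_hadamard n k H" and "normalized H"
    and "l = (LEAST i. i \<ge> 2 \<and> i dvd k)"
  shows
    "(\<exists>d. is_code k (n - 1) n d (code_A H')
        \<and> ereal_of_enat d \<ge> ereal (real n - real n / real l))
   \<and> (\<exists>M d. is_code k (n - 1) M d (code_B k \<zeta> H)
        \<and> (n \<ge> 3 \<longrightarrow> M = n * k)
        \<and> ereal_of_enat d \<ge> ereal (real n - real n / real l - 1))
   \<and> (\<exists>d. is_code k n (n * k) d (code_C k \<zeta> H)
        \<and> ereal_of_enat d \<ge> ereal (real n - real n / real l))
   \<and> (n = k \<longrightarrow> (\<forall>c \<in> {1..<n}. \<exists>d. is_code k (n + 1) (n ^ 2) d (code_D k \<zeta> H c)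
        \<and> ereal_of_enat d \<ge> ereal (real n - real n / real l)))"
proof -
  define R where "R = root_exponent k \<zeta>"
  define N where "N = roots_of_unity k"
  define r where "r = real n - real n / real l"
  note z = assms(3) and H = assms(7)
  have l: "l \<ge> 2" "l dvd k"
    using LeastI[of "\<lambda>i. i \<ge> 2 \<and> i dvd k" k] assms(2,9) by auto
  have lp: "l \<le> p" if "prime p" "p dvd k" for p
    unfolding assms(9) using that by (intro Least_le) (auto simp: prime_ge_2_nat)
  have r0: "r > 0" using assms(1) l by (simp add: r_def field_simps)
  \<comment> \<open>\<open>l \<ge> 2\<close> gives \<open>r - 1 \<ge> n / 2 - 1\<close>.\<close>
  have r3: "r - 1 > 0" if "n \<ge> 3"
  proof -
    have "real n / real l \<le> real n / 2" using l by (intro divide_left_mono) auto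
    then show ?thesis using that by (simp add: r_def)
  qed
  have dimH: "H \<in> carrier_mat n n" using H by (simp add: butson_hadamard_def)
  have NI: "finite N" "card N = k"
    unfolding N_def range_power_primitive_root[OF z, symmetric]
    using inj_on_power_primitive_root[OF z] by (auto simp: card_image)
  have N1: "1 \<in> N" by (simp add: N_def roots_of_unity_def)
  \<comment> \<open>\<open>W (u, i)\<close> is row \<open>i\<close> of the exponent matrix of
    \<open>u\<close> times \<open>H\<close>; the words of all four codes are cut from it.\<close>
  define W where "W = (\<lambda>(u, i) j. R (u * H $$ (i, j)))"
  have WN: "u * H $$ (i, j) \<in> roots_of_unity k" if "u \<in> N" "i < n" "j < n" for u i j
    using that butson_hadamard_entry[OF H] by (auto simp: N_def intro: roots_of_unity_mult)
  have W: "W s j < k" if "s \<in> N \<times> {..<n}" "j < n" for s j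
    using that WN by (auto simp: W_def R_def intro!: root_exponent_less[OF z])
  have Wdist: "r \<le> real (card {j. j < n \<and> W s j \<noteq> W t j})"
    if "s \<in> N \<times> {..<n}" "t \<in> N \<times> {..<n}" "s \<noteq> t" for s t
  proof -
    have "l * card {j. j < n \<and> W s j = W t j} \<le> n"
    proof -
      obtain u i u' i' where st: "s = (u, i)" "t = (u', i')" by fastforce
      show ?thesis
        using card_exponent_agreements_le[OF z assms(2) lp H, of u u' i i'] that
        unfolding st W_def R_def N_def by simp
    qed
    then have "real l * real (card {j. j < n \<and> W s j = W t j}) \<le> real n"
      by (metis of_nat_le_iff of_nat_mult)
    then have "real (card {j. j < n \<and> W s j = W t j}) \<le> real n / real l"
      using l by (simp add: field_simps)
    moreover have "card {j. j < n \<and> W s j = W t j} + card {j. j < n \<and> W s j \<noteq> W t j} = n"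
    proof -
      have "card ({j. j < n \<and> W s j = W t j} \<union> {j. j < n \<and> W s j \<noteq> W t j}) =
          card {j. j < n \<and> W s j = W t j} + card {j. j < n \<and> W s j \<noteq> W t j}"
        by (rule card_Un_disjoint) auto
      moreover have "{j. j < n \<and> W s j = W t j} \<union> {j. j < n \<and> W s j \<noteq> W t j} = {..<n}"
        by auto
      ultimately show ?thesis by simp
    qed
    ultimately show ?thesis unfolding r_def by linarith
  qed
  \<comment> \<open>The entries of \<open>H'\<close> are reduced residues, so
    \<open>root_exponent\<close> recovers them and \<open>A_k\<close> is the slice
    \<open>u = 1\<close>.\<close>
  have W1: "H' $$ (i, j) = W (1, i) j" if "i < n" "j < n" for i j
  proof -
    have "H' $$ (i, j) < k" using elements_matI[OF assms(4) that] assms(5) by blast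
    then show ?thesis
      using that assms(4,6) by (simp add: W_def R_def root_exponent_power[OF z])
  qed
  \<comment> \<open>Normalization makes column 0 of \<open>H\<close> constant, so its deletion costs
    words with \<open>u = 1\<close> no disagreement.\<close>
  have W10: "W (1, i) 0 = W (1, i') 0" if "i < n" "i' < n" for i i'
    using that assms(8) dimH by (simp add: W_def normalized_def)
  define del where "del s = vec (n - 1) (\<lambda>j. W s (j + 1))" for s
  define full where "full s = vec n (W s)" for s
  \<comment> \<open>The last coordinate takes \<open>W\<close> at \<open>u = 1\<close>, as the
    appended column is that of the unscaled \<open>H\<close>.\<close>
  define app where "app c s = vec (n + 1) (\<lambda>j. if j < n then W s j else W (1, snd s) c)" for c s

  \<comment> \<open>The codes as images of indexed families\<close>
  have code_A: "code_A H' = (\<lambda>i. del (1, i)) ` {..<n}"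
  proof -
    have "row (delete_first_col H') i = del (1, i)" if "i < n" for i
      using that assms(4) W1 by (auto simp: delete_first_col_def del_def)
    moreover have "dim_row (delete_first_col H') = n"
      using assms(4) by (simp add: delete_first_col_def)
    ultimately show ?thesis
      by (auto simp: code_A_def rows_def atLeast0LessThan intro!: image_cong)
  qed
  have code_B: "code_B k \<zeta> H = del ` (N \<times> {..<n})"
  proof -
    have "row (delete_first_col (exponent_matrix k \<zeta> (u \<cdot>\<^sub>m H))) i = del (u, i)" if "i < n" for u i
      using that dimH by (auto simp: delete_first_col_def exponent_matrix_def del_def W_def R_def)
    moreover have "dim_row (delete_first_col (exponent_matrix k \<zeta> (u \<cdot>\<^sub>m H))) = n" for u
      using dimH by (simp add: delete_first_col_def exponent_matrix_def)
    ultimately have "set (rows (delete_first_col (exponent_matrix k \<zeta> (u \<cdot>\<^sub>m H)))) =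
        (\<lambda>i. del (u, i)) ` {..<n}" for u
      by (auto simp: rows_def atLeast0LessThan intro!: image_cong)
    then show ?thesis by (auto simp: code_B_def N_def)
  qed
  have code_C: "code_C k \<zeta> H = full ` (N \<times> {..<n})"
  proof -
    have "row (exponent_matrix k \<zeta> (u \<cdot>\<^sub>m H)) i = full (u, i)" if "i < n" for u i
      using that dimH by (auto simp: exponent_matrix_def full_def W_def R_def)
    moreover have "dim_row (exponent_matrix k \<zeta> (u \<cdot>\<^sub>m H)) = n" for u
      using dimH by (simp add: exponent_matrix_def)
    ultimately have "set (rows (exponent_matrix k \<zeta> (u \<cdot>\<^sub>m H))) = (\<lambda>i. full (u, i)) ` {..<n}" for u
      by (auto simp: rows_def atLeast0LessThan intro!: image_cong)
    then show ?thesis by (auto simp: code_C_def N_def)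
  qed
  have code_D: "code_D k \<zeta> H c = app c ` (N \<times> {..<n})" if "c < n" for c
  proof -
    have "row (exponent_matrix k \<zeta> (append_col (u \<cdot>\<^sub>m H) (col H c))) i = app c (u, i)"
      if "i < n" for u i
      using that \<open>c < n\<close> dimH
      by (auto simp: exponent_matrix_def append_col_def app_def W_def R_def)
    moreover have "dim_row (exponent_matrix k \<zeta> (append_col (u \<cdot>\<^sub>m H) (col H c))) = n" for u
      using dimH by (simp add: exponent_matrix_def append_col_def)
    ultimately have "set (rows (exponent_matrix k \<zeta> (append_col (u \<cdot>\<^sub>m H) (col H c)))) =
        (\<lambda>i. app c (u, i)) ` {..<n}" for u
      by (auto simp: rows_def atLeast0LessThan intro!: image_cong)
    then show ?thesis by (auto simp: code_D_def N_def)
  qed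

  \<comment> \<open>Alphabet, distances and sizes\<close>
  have del: "set\<^sub>v (del s) \<subseteq> {..<k}" if "s \<in> N \<times> {..<n}" for s
    using W[OF that] by (auto simp: del_def vec_set_def)
  have full: "set\<^sub>v (full s) \<subseteq> {..<k}" if "s \<in> N \<times> {..<n}" for s
    using W[OF that] by (auto simp: full_def vec_set_def)
  have app: "set\<^sub>v (app c s) \<subseteq> {..<k}" if "s \<in> N \<times> {..<n}" "c < n" for c s
    using W that N1 by (auto simp: app_def vec_set_def)
  have ne: "N \<times> {..<n} \<noteq> {}" "finite (N \<times> {..<n})" "card (N \<times> {..<n}) = n * k"
    using assms(1) NI N1 by (auto simp: card_cartesian_product lessThan_empty_iff)

  have A: "r \<le> real (hamming_dist (del (1, i)) (del (1, i')))"
    if "i \<in> {..<n}" "i' \<in> {..<n}" "i \<noteq> i'" for i i'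
    using that Wdist[of "(1, i)" "(1, i')"] N1 W10[of i i']
      card_neq_Suc[OF assms(1), of "W (1, i)" "W (1, i')"]
    by (simp add: del_def hamming_dist_vec)
  have B: "r - 1 \<le> real (hamming_dist (del s) (del t))"
    if "s \<in> N \<times> {..<n}" "t \<in> N \<times> {..<n}" "s \<noteq> t" for s t
    using Wdist[OF that] card_neq_Suc[OF assms(1), of "W s" "W t"]
    by (simp add: del_def hamming_dist_vec split: if_splits)
  have C: "r \<le> real (hamming_dist (full s) (full t))"
    if "s \<in> N \<times> {..<n}" "t \<in> N \<times> {..<n}" "s \<noteq> t" for s t
    using Wdist[OF that] by (simp add: full_def hamming_dist_vec)
  \<comment> \<open>An appended coordinate can only add disagreements, so the bound for full rows
    carries over.\<close>
  have D: "r \<le> real (hamming_dist (app c s) (app c t))"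
    if "s \<in> N \<times> {..<n}" "t \<in> N \<times> {..<n}" "s \<noteq> t" for c s t
  proof -
    have "card {j. j < n \<and> W s j \<noteq> W t j} \<le> hamming_dist (app c s) (app c t)"
      unfolding app_def hamming_dist_vec by (rule card_mono) auto
    then show ?thesis using Wdist[OF that] by linarith
  qed
  have delc: "del s \<in> carrier_vec (n - 1)" and fullc: "full s \<in> carrier_vec n"
    and appc: "app c s \<in> carrier_vec (n + 1)" for c s
    by (simp_all add: del_def full_def app_def)
  have I: "{..<n} \<noteq> {}" using assms(1) by (auto simp: lessThan_empty_iff)
  have del1: "set\<^sub>v (del (1, i)) \<subseteq> {..<k}" if "i \<in> {..<n}" for i
    using that N1 del by simp
  have "\<exists>M d. is_code k (n - 1) M d (code_A H') \<and> (r > 0 \<longrightarrow> M = card {..<n})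
      \<and> ereal_of_enat d \<ge> ereal r"
    unfolding code_A by (rule is_code_image[OF finite_lessThan I delc del1 A])
  then have "\<exists>d. is_code k (n - 1) n d (code_A H') \<and> ereal_of_enat d \<ge> ereal r"
    using r0 by auto
  moreover
  have "\<exists>M d. is_code k (n - 1) M d (code_B k \<zeta> H)
      \<and> (r - 1 > 0 \<longrightarrow> M = card (N \<times> {..<n})) \<and> ereal_of_enat d \<ge> ereal (r - 1)"
    unfolding code_B by (rule is_code_image[OF ne(2,1) delc del B])
  then have "\<exists>M d. is_code k (n - 1) M d (code_B k \<zeta> H) \<and> (n \<ge> 3 \<longrightarrow> M = n * k)
      \<and> ereal_of_enat d \<ge> ereal (r - 1)"
    using r3 unfolding ne(3) by blast
  moreover
  have "\<exists>M d. is_code k n M d (code_C k \<zeta> H)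
      \<and> (r > 0 \<longrightarrow> M = card (N \<times> {..<n})) \<and> ereal_of_enat d \<ge> ereal r"
    unfolding code_C by (rule is_code_image[OF ne(2,1) fullc full C])
  then have "\<exists>d. is_code k n (n * k) d (code_C k \<zeta> H) \<and> ereal_of_enat d \<ge> ereal r"
    using r0 unfolding ne(3) by blast
  moreover have "\<exists>d. is_code k (n + 1) (n ^ 2) d (code_D k \<zeta> H c) \<and> ereal_of_enat d \<ge> ereal r"
    if "n = k" "c \<in> {1..<n}" for c
  proof -
    have c: "c < n" using that by simp
    have nk: "n * k = n ^ 2" using that by (simp add: power2_eq_square)
    have "\<exists>M d. is_code k (n + 1) M d (code_D k \<zeta> H c)
        \<and> (r > 0 \<longrightarrow> M = card (N \<times> {..<n})) \<and> ereal_of_enat d \<ge> ereal r"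
      unfolding code_D[OF c] by (rule is_code_image[OF ne(2,1) appc app[OF _ c] D])
    then show ?thesis using r0 unfolding ne(3) nk by blast
  qed
  ultimately show ?thesis unfolding r_def by blast
qed

end
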